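(* Let $(\mathbb{R}^n,g)$ be a pseudo-Euclidean space, $n\ge 3$, with coordinates $x=(x_1,\dots,x_n)$ and $g_{ij}=\delta_{ij}\varepsilon_i$, $\varepsilon_i\in\{-1,1\}$. Let $M=(\mathbb{R}^n,\bar g)\times_f F^m$ be a warped product, where $\bar g=\frac{1}{\varphi^2}g$, $F$ is a semi-Riemannian manifold of dimension $m\ge 1$ with constant scalar curvature $\lambda_F$, $f,\varphi,h:\mathbb{R}^n\to\mathbb{R}$ are smooth functions, and $f>0$. Assume $f=f(\xi)$, $\varphi=\varphi(\xi)$, $h=h(\xi)$ are functions of $\xi=\sum_{k=1}^n\alpha_kx_k$, where $\alpha_k\in\mathbb{R}$, $(\alpha_1,\dots,\alpha_n)\ne 0$, and either $\sum_{k=1}^n\varepsilon_k\alpha_k^2=\varepsilon_{k_0}\in\{-1,1\}$ or $\sum_{k=1}^n\varepsilon_k\alpha_k^2=0$. Let $\rho\in\mathbb{R}$. Then the warped product metric $\tilde g=\bar g\oplus f^2g_F$ is a gradient Yamabe soliton with potential function $h$ and constant $\rho$, that is, $(S_{\tilde g}-\rho)\tilde g=\mathrm{Hess}_{\tilde g}(h)$, if and only if $f,h,\varphi$ satisfy: (1) when $\sum_{k}\varepsilon_k\alpha_k^2=\varepsilon_{k_0}$: $$h''+2\frac{\varphi'h'}{\varphi}=0,$$ $$\varepsilon_{k_0}\Big[(n-1)(2\varphi\varphi''-n(\varphi')^2)-\frac{2m}{f}\big(\varphi^2f''-(n-2)\varphi\varphi'f'\big)-\frac{m(m-1)}{f^2}\varphi^2(f')^2+\varphi'h'\varphi\Big]=\rho-\frac{\lambda_F}{f^2},$$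 $$\varepsilon_{k_0}\Big[(n-1)(2\varphi\varphi''-n(\varphi')^2)-\frac{2m}{f}\big(\varphi^2f''-(n-2)\varphi\varphi'f'\big)-\frac{m(m-1)}{f^2}\varphi^2(f')^2-\frac{\varphi^2}{f}f'h'\Big]=\rho-\frac{\lambda_F}{f^2};$$ (2) when $\sum_{k}\varepsilon_k\alpha_k^2=0$: $$h''+2\frac{\varphi'h'}{\varphi}=0,\qquad \rho-\frac{\lambda_F}{f^2}=0.$$
   Context: A pseudo-Riemannian manifold $(M,g)$ is a gradient Yamabe soliton with potential function $h$ if there is a real constant $\rho$ with $(S_g-\rho)g=\mathrm{Hess}_g(h)$, where $S_g$ is the scalar curvature. The warped product $B\times_f F$ is $B\times F$ with metric $\tilde g=g_B\oplus f^2g_F$. The function $h$ on $\mathbb{R}^n$ is regarded as a function on $M=\mathbb{R}^n\times F$ by composing with the projection to $\mathbb{R}^n$. Since $\bar g=\frac1{\varphi^2}g$ must be a metric, $\varphi$ is nowhere zero. Primes denote derivatives with respect to $\xi$. *)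

theory Defs
  imports "HOL-Analysis.Analysis"
begin

section \<open>Partial derivatives and smooth functions on open subsets of Euclidean space\<close>

definition partial :: "'d::finite \<Rightarrow> (real^'d \<Rightarrow> real) \<Rightarrow> real^'d \<Rightarrow> real" where
  "partial k F y = deriv (\<lambda>t. F (y + t *\<^sub>R axis k 1)) 0"

text \<open>\<open>C\<^sup>\<infinity>\<close> on \<open>S\<close>; only meant for open \<open>S\<close>. Differentiability of all iterated partial
  derivatives makes each of them continuous.\<close>

definition smooth_on :: "(real^'d) set \<Rightarrow> (real^'d::finite \<Rightarrow> real) \<Rightarrow> bool" where
  "smooth_on S F \<longleftrightarrow> (\<forall>ks. foldr partial ks F differentiable_on S)"

section \<open>Semi-Riemannian manifolds\<close>

text \<open>A manifold, modelled on \<open>\<real>\<^sup>d\<close> and with point set the whole type \<open>'p\<close>, is given by an atlas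
  indexed by \<open>atlas\<close>: \<open>coords i\<close> is the chart on \<open>cdom i\<close> and \<open>param i\<close> its inverse. A
  \<open>(0,2)\<close>-tensor field \<open>g\<close> is given classically by its components: \<open>gcomp i p $ a $ b\<close> is
  \<open>g\<^sub>p(\<partial>\<^sub>a, \<partial>\<^sub>b)\<close> for the coordinate vectors of chart \<open>i\<close> at \<open>p\<close>.\<close>

record ('i, 'p, 'd) semi_riem =
  atlas :: "'i set"
  cdom :: "'i \<Rightarrow> 'p set"
  coords :: "'i \<Rightarrow> 'p \<Rightarrow> real^'d::finite"
  param :: "'i \<Rightarrow> real^'d::finite \<Rightarrow> 'p"
  gcomp :: "'i \<Rightarrow> 'p \<Rightarrow> real^'d::finite^'d::finite"

definition cimage :: "('i, 'p, 'd::finite) semi_riem \<Rightarrow> 'i \<Rightarrow> (real^'d) set" where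
  "cimage M i = coords M i ` cdom M i"

definition smooth_manifold ::
  "('i, 'p::{t2_space, second_countable_topology}, 'd::finite) semi_riem \<Rightarrow> bool" where
  "smooth_manifold M \<longleftrightarrow>
     (\<Union>i\<in>atlas M. cdom M i) = UNIV \<and>
     (\<forall>i\<in>atlas M. open (cdom M i) \<and> open (cimage M i) \<and>
        homeomorphism (cdom M i) (cimage M i) (coords M i) (param M i)) \<and>
     (\<forall>i\<in>atlas M. \<forall>j\<in>atlas M. \<forall>a.
        smooth_on (coords M i ` (cdom M i \<inter> cdom M j)) (\<lambda>y. coords M j (param M i y) $ a))"

text \<open>The index of a symmetric bilinear form: the largest dimension of a subspace on which it is
  negative definite.\<close>

definition form_index :: "real^'d^'d::finite \<Rightarrow> nat" where
  "form_index A = (GREATEST k. \<exists>V. subspace V \<and> dim V = k \<and> (\<forall>v\<in>V. v \<noteq> 0 \<longrightarrow> v \<bullet> (A *v v) < 0))"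

definition semi_riemannian ::
  "('i, 'p::{t2_space, second_countable_topology}, 'd::finite) semi_riem \<Rightarrow> bool" where
  "semi_riemannian M \<longleftrightarrow> smooth_manifold M \<and>
     (\<forall>i\<in>atlas M. \<forall>j\<in>atlas M. \<forall>p\<in>cdom M i \<inter> cdom M j.
        let J = jacobian (\<lambda>y. coords M j (param M i y)) (at (coords M i p))
        in gcomp M i p = transpose J ** gcomp M j p ** J) \<and>
     (\<forall>i\<in>atlas M. \<forall>a b. smooth_on (cimage M i) (\<lambda>y. gcomp M i (param M i y) $ a $ b)) \<and>
     (\<forall>i\<in>atlas M. \<forall>p\<in>cdom M i. transpose (gcomp M i p) = gcomp M i p \<and> invertible (gcomp M i p)) \<and>
     (\<exists>\<nu>. \<forall>i\<in>atlas M. \<forall>p\<in>cdom M i. form_index (gcomp M i p) = \<nu>)"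

section \<open>Curvature and Hessian in coordinates\<close>

text \<open>Here \<open>G\<close> is a metric on an open subset of \<open>\<real>\<^sup>d\<close>. \<open>christoffel G k i j\<close> is \<open>\<Gamma>\<^sup>k\<^sub>i\<^sub>j\<close>, and
  \<open>riemann G l i j k\<close> is the \<open>\<partial>\<^sub>l\<close>-component of \<open>R(\<partial>\<^sub>i, \<partial>\<^sub>j)\<partial>\<^sub>k\<close> with
  \<open>R(X,Y)Z = \<nabla>\<^sub>X\<nabla>\<^sub>YZ - \<nabla>\<^sub>Y\<nabla>\<^sub>XZ - \<nabla>\<^bsub>[X,Y]\<^esub>Z\<close>, so that round spheres have positive scalar curvature.\<close>

definition christoffel ::
  "(real^'d \<Rightarrow> real^'d^'d) \<Rightarrow> 'd::finite \<Rightarrow> 'd \<Rightarrow> 'd \<Rightarrow> real^'d \<Rightarrow> real" where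
  "christoffel G k i j y = 1/2 * (\<Sum>l\<in>UNIV. matrix_inv (G y) $ k $ l *
     (partial i (\<lambda>z. G z $ j $ l) y + partial j (\<lambda>z. G z $ i $ l) y - partial l (\<lambda>z. G z $ i $ j) y))"

definition riemann ::
  "(real^'d \<Rightarrow> real^'d^'d) \<Rightarrow> 'd::finite \<Rightarrow> 'd \<Rightarrow> 'd \<Rightarrow> 'd \<Rightarrow> real^'d \<Rightarrow> real" where
  "riemann G l i j k y =
     partial i (christoffel G l j k) y - partial j (christoffel G l i k) y +
     (\<Sum>s\<in>UNIV. christoffel G l i s y * christoffel G s j k y
               - christoffel G l j s y * christoffel G s i k y)"

definition ricci :: "(real^'d \<Rightarrow> real^'d^'d) \<Rightarrow> 'd::finite \<Rightarrow> 'd \<Rightarrow> real^'d \<Rightarrow> real" where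
  "ricci G j k y = (\<Sum>i\<in>UNIV. riemann G i i j k y)"

definition scalar_curv :: "(real^'d \<Rightarrow> real^'d^'d) \<Rightarrow> real^'d::finite \<Rightarrow> real" where
  "scalar_curv G y = (\<Sum>j\<in>UNIV. \<Sum>k\<in>UNIV. matrix_inv (G y) $ j $ k * ricci G j k y)"

definition hess ::
  "(real^'d \<Rightarrow> real^'d^'d) \<Rightarrow> (real^'d \<Rightarrow> real) \<Rightarrow> 'd::finite \<Rightarrow> 'd \<Rightarrow> real^'d \<Rightarrow> real" where
  "hess G u i j y = partial i (partial j u) y - (\<Sum>k\<in>UNIV. christoffel G k i j y * partial k u y)"

text \<open>On a manifold both are computed in a chart \<open>i\<close> around \<open>p\<close>. For a semi-Riemannian manifold
  the scalar curvature at \<open>p\<close> does not depend on \<open>i\<close>, and the Hessian transforms as a tensor;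
  the conditions below are imposed in every chart of the atlas.\<close>

definition local_metric ::
  "('i, 'p, 'd::finite) semi_riem \<Rightarrow> 'i \<Rightarrow> real^'d \<Rightarrow> real^'d^'d" where
  "local_metric M i y = gcomp M i (param M i y)"

definition scalar_curvature :: "('i, 'p, 'd::finite) semi_riem \<Rightarrow> 'i \<Rightarrow> 'p \<Rightarrow> real" where
  "scalar_curvature M i p = scalar_curv (local_metric M i) (coords M i p)"

definition hessian ::
  "('i, 'p, 'd::finite) semi_riem \<Rightarrow> ('p \<Rightarrow> real) \<Rightarrow> 'i \<Rightarrow> 'p \<Rightarrow> real^'d^'d" where
  "hessian M u i p =
     (\<chi> a b. hess (local_metric M i) (\<lambda>y. u (param M i y)) a b (coords M i p))"

definition has_constant_scalar_curvature :: "('i, 'p, 'd::finite) semi_riem \<Rightarrow> real \<Rightarrow> bool" where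
  "has_constant_scalar_curvature M c \<longleftrightarrow> (\<forall>i\<in>atlas M. \<forall>p\<in>cdom M i. scalar_curvature M i p = c)"

definition gradient_yamabe_soliton ::
  "('i, 'p, 'd::finite) semi_riem \<Rightarrow> ('p \<Rightarrow> real) \<Rightarrow> real \<Rightarrow> bool" where
  "gradient_yamabe_soliton M h \<rho> \<longleftrightarrow>
     (\<forall>i\<in>atlas M. \<forall>p\<in>cdom M i.
        (scalar_curvature M i p - \<rho>) *\<^sub>R gcomp M i p = hessian M h i p)"

section \<open>Pseudo-Euclidean space, conformal change, warped products\<close>

definition pseudo_euclidean :: "('n::finite \<Rightarrow> real) \<Rightarrow> (unit, real^'n, 'n) semi_riem" where
  "pseudo_euclidean \<epsilon> =
     \<lparr>atlas = UNIV, cdom = (\<lambda>_. UNIV), coords = (\<lambda>_ x. x), param = (\<lambda>_ x. x),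
      gcomp = (\<lambda>_ _. \<chi> i j. if i = j then \<epsilon> i else 0)\<rparr>"

definition conformal :: "('p \<Rightarrow> real) \<Rightarrow> ('i, 'p, 'd::finite) semi_riem \<Rightarrow> ('i, 'p, 'd) semi_riem" where
  "conformal \<phi> M = M\<lparr>gcomp := (\<lambda>i p. (1 / (\<phi> p)\<^sup>2) *\<^sub>R gcomp M i p)\<rparr>"

text \<open>The warped product carries the product atlas, with coordinates indexed by the disjoint sum
  \<open>'b + 'c\<close>, and the block diagonal metric \<open>g\<^sub>B \<oplus> f\<^sup>2 g\<^sub>F\<close>.\<close>

definition warped_product ::
  "('i, 'p, 'b::finite) semi_riem \<Rightarrow> ('p \<Rightarrow> real) \<Rightarrow> ('j, 'q, 'c::finite) semi_riem
    \<Rightarrow> ('i \<times> 'j, 'p \<times> 'q, 'b + 'c) semi_riem" where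
  "warped_product B f F =
     \<lparr>atlas = atlas B \<times> atlas F,
      cdom = (\<lambda>(i, j). cdom B i \<times> cdom F j),
      coords = (\<lambda>(i, j) (p, q). \<chi> s. case s of Inl a \<Rightarrow> coords B i p $ a | Inr c \<Rightarrow> coords F j q $ c),
      param = (\<lambda>(i, j) y. (param B i (\<chi> a. y $ Inl a), param F j (\<chi> c. y $ Inr c))),
      gcomp = (\<lambda>(i, j) (p, q). \<chi> s t.
        case (s, t) of
          (Inl a, Inl b) \<Rightarrow> gcomp B i p $ a $ b
        | (Inr c, Inr d) \<Rightarrow> (f p)\<^sup>2 * gcomp F j q $ c $ d
        | _ \<Rightarrow> 0)\<rparr>"

end

theory Submission
  imports Defs
begin

text \<open>Write \<open>e = \<Sum>\<^sub>k \<epsilon>\<^sub>k \<alpha>\<^sub>k\<^sup>2\<close>, and \<open>n\<close>, \<open>m\<close> for the dimensions of base and fibre. Both the scalar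
  curvature and the Hessian of the potential can be computed in closed form, and the soliton
  equation is then a comparison of symmetric tensors.

  For a block metric \<open>A \<oplus> f\<^sup>2 H\<close> the Christoffel symbols are those of \<open>A\<close> and \<open>H\<close>, together with
  \<open>\<Gamma>\<^sup>a\<^sub>c\<^sub>d = - f (grad f)\<^sup>a H\<^sub>c\<^sub>d\<close> and \<open>\<Gamma>\<^sup>c\<^sub>a\<^sub>d = \<delta>\<^sup>c\<^sub>d \<partial>\<^sub>a f / f\<close> (\<open>christoffel_G\<close>). Hence the scalar curvature
  is \<open>S\<^sub>A + S\<^sub>H / f\<^sup>2 - 2 m \<Delta>f / f - m (m - 1) |grad f|\<^sup>2 / f\<^sup>2\<close> (\<open>scalar_curv_G\<close>), and a potential that
  depends on the base point only has the Hessian of the base in the base block, no mixed entries, and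
  \<open>f \<langle>grad f, grad h\<rangle> H\<close> in the fibre block (\<open>hess_G\<close>).

  For the base metric \<open>g / \<phi>(\<xi>)\<^sup>2\<close> every tensor involved is a combination of \<open>\<alpha> \<otimes> \<alpha>\<close> and \<open>g\<close> with
  coefficients depending on \<open>\<xi>\<close>. This gives \<open>S\<^sub>A = e (n - 1) (2 \<phi> \<phi>'' - n \<phi>'\<^sup>2)\<close> (\<open>scalar_curv_A\<close>) and
  \<open>Hess h = (h'' + 2 \<phi>' h' / \<phi>) \<alpha> \<otimes> \<alpha> - e (\<phi>' / \<phi>) h' g\<close> (\<open>hess_profile\<close>).

  The base block of the soliton equation therefore equates a multiple of \<open>g\<close> with a multiple of
  \<open>\<alpha> \<otimes> \<alpha>\<close>. Since \<open>g\<close> has rank at least two, both coefficients vanish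
  (\<open>diagonal_eq_rank_one_iff\<close>): these are the first two equations. The fibre block is a multiple of
  \<open>g\<^sub>F\<close> and gives the third. When \<open>e = 0\<close> the last two both reduce to \<open>\<rho> - \<lambda>\<^sub>F / f\<^sup>2 = 0\<close>. As the fibre
  is nonempty and \<open>\<xi>\<close> maps onto \<open>\<real>\<close>, equations at all points of the product are equations at all
  values of \<open>\<xi>\<close>.\<close>

section \<open>Partial derivatives, inverse matrices and sums over a disjoint union\<close>

lemma partial_eqI:
  "((\<lambda>t. F (y + t *\<^sub>R axis k 1)) has_field_derivative D) (at 0) \<Longrightarrow> partial k F y = D"
  unfolding partial_def by (rule DERIV_imp_deriv)

text \<open>Partial derivatives are defined as ordinary derivatives along a coordinate line, so the
  product and quotient rules come from the one-variable ones.\<close>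

lemma has_partial:
  assumes "F differentiable (at y)"
  shows "((\<lambda>t. F (y + t *\<^sub>R axis k 1)) has_field_derivative partial k F y) (at 0)"
proof -
  have "(\<lambda>t::real. y + t *\<^sub>R axis k 1) differentiable (at 0)"
    by (auto intro!: derivative_intros)
  then have "(F \<circ> (\<lambda>t::real. y + t *\<^sub>R axis k 1)) differentiable (at 0)"
    using assms by (intro differentiable_chain_at) auto
  then have "\<exists>D. ((\<lambda>t. F (y + t *\<^sub>R axis k 1)) has_field_derivative D) (at 0)"
    by (simp add: real_differentiable_def o_def)
  then show ?thesis
    unfolding partial_def by (simp add: DERIV_deriv_iff_has_field_derivative)
qed

lemma partial_const [simp]: "partial k (\<lambda>_. c) y = 0"
  by (rule partial_eqI) auto

lemma partial_mult:
  assumes "F differentiable (at y)" "K differentiable (at y)"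
  shows "partial k (\<lambda>z. F z * K z) y = partial k F y * K y + F y * partial k K y"
  by (rule partial_eqI)
     (use DERIV_mult[OF has_partial[OF assms(1), of k] has_partial[OF assms(2), of k]]
      in \<open>simp add: algebra_simps\<close>)

lemma partial_cmult:
  assumes "F differentiable (at y)"
  shows "partial k (\<lambda>z. c * F z) y = c * partial k F y"
  using partial_mult[OF differentiable_const assms, of k c] by simp

lemma partial_divide:
  assumes "F differentiable (at y)" "K differentiable (at y)" "K y \<noteq> 0"
  shows "partial k (\<lambda>z. F z / K z) y =
    (partial k F y * K y - F y * partial k K y) / (K y)\<^sup>2"
  by (rule partial_eqI)
     (use DERIV_divide[OF has_partial[OF assms(1), of k] has_partial[OF assms(2), of k]] assms(3)
      in \<open>simp add: power2_eq_square\<close>)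

text \<open>Christoffel symbols are known in closed form only over the domain of a chart; by locality
  the closed form may be differentiated there.\<close>

lemma partial_cong_open:
  assumes "open S" "y \<in> S" "\<And>z. z \<in> S \<Longrightarrow> F z = K z"
  shows "partial k F y = partial k K y"
proof -
  have "open ((\<lambda>t::real. y + t *\<^sub>R axis k 1) -` S)" (is "open ?T")
    by (intro open_vimage assms(1) continuous_intros)
  moreover have "0 \<in> ?T"
    using assms(2) by simp
  ultimately have "eventually (\<lambda>t. t \<in> ?T) (nhds 0)"
    by (rule eventually_nhds_in_open)
  then have "eventually (\<lambda>t. F (y + t *\<^sub>R axis k 1) = K (y + t *\<^sub>R axis k 1)) (nhds 0)"
    by (rule eventually_mono) (simp add: assms(3))
  then show ?thesis
    unfolding partial_def by (rule deriv_cong_ev) simp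
qed

lemma matrix_inv_eqI:
  fixes A B :: "real^'n^'n"
  assumes "A ** B = mat 1"
  shows "matrix_inv A = B"
proof -
  have BA: "B ** A = mat 1"
    using assms by (simp add: matrix_left_right_inverse)
  have "A ** matrix_inv A = mat 1 \<and> matrix_inv A ** A = mat 1"
    unfolding matrix_inv_def by (rule someI[of _ B]) (use assms BA in auto)
  then have "B = B ** (A ** matrix_inv A)"
    by simp
  also have "\<dots> = matrix_inv A"
    unfolding matrix_mul_assoc BA by simp
  finally show ?thesis ..
qed

lemma matrix_inv_mult:
  fixes A :: "real^'n^'n"
  assumes "invertible A"
  shows "A ** matrix_inv A = mat 1" "matrix_inv A ** A = mat 1"
proof -
  from assms obtain B where "A ** B = mat 1" "B ** A = mat 1"
    unfolding invertible_def by blast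
  then show "A ** matrix_inv A = mat 1" "matrix_inv A ** A = mat 1"
    by (simp_all add: matrix_inv_eqI)
qed

lemma matrix_inv_entry:
  fixes B :: "real^'d^'d::finite"
  assumes "invertible B"
  shows "(\<Sum>l\<in>UNIV. B $ i $ l * matrix_inv B $ l $ j) = (if i = j then 1 else 0)"
    and "(\<Sum>l\<in>UNIV. matrix_inv B $ i $ l * B $ l $ j) = (if i = j then 1 else 0)"
  using matrix_inv_mult[OF assms]
  by (simp_all add: vec_eq_iff matrix_matrix_mult_def mat_def)

lemma sum_UNIV_sum:
  fixes g :: "'a::finite + 'b::finite \<Rightarrow> 'c::comm_monoid_add"
  shows "(\<Sum>s\<in>UNIV. g s) = (\<Sum>a\<in>UNIV. g (Inl a)) + (\<Sum>c\<in>UNIV. g (Inr c))"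
  unfolding UNIV_Plus_UNIV[symmetric] by (subst sum.Plus) auto

section \<open>Metrics of the form \<open>A \<oplus> f\<^sup>2 H\<close> in product coordinates\<close>

definition lpart :: "real^('b::finite + 'c::finite) \<Rightarrow> real^'b" where
  "lpart y = (\<chi> a. y $ Inl a)"

definition rpart :: "real^('b::finite + 'c::finite) \<Rightarrow> real^'c" where
  "rpart y = (\<chi> c. y $ Inr c)"

definition warped_metric ::
  "(real^'b \<Rightarrow> real^'b^'b) \<Rightarrow> (real^'b \<Rightarrow> real) \<Rightarrow> (real^'c \<Rightarrow> real^'c^'c)
    \<Rightarrow> real^('b::finite + 'c::finite) \<Rightarrow> real^('b + 'c)^('b + 'c)" where
  "warped_metric A f H y = (\<chi> s t.
     case (s, t) of
       (Inl a, Inl b) \<Rightarrow> A (lpart y) $ a $ b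
     | (Inr c, Inr d) \<Rightarrow> (f (lpart y))\<^sup>2 * H (rpart y) $ c $ d
     | _ \<Rightarrow> 0)"

definition gradient :: "(real^'d \<Rightarrow> real^'d^'d) \<Rightarrow> (real^'d \<Rightarrow> real) \<Rightarrow> 'd::finite \<Rightarrow> real^'d \<Rightarrow> real" where
  "gradient G u k x = (\<Sum>l\<in>UNIV. matrix_inv (G x) $ k $ l * partial l u x)"

definition divergence :: "(real^'d \<Rightarrow> real^'d^'d) \<Rightarrow> ('d::finite \<Rightarrow> real^'d \<Rightarrow> real) \<Rightarrow> real^'d \<Rightarrow> real" where
  "divergence G X x = (\<Sum>i\<in>UNIV. partial i (X i) x + (\<Sum>s\<in>UNIV. christoffel G i i s x * X s x))"

lemma lpart_add_axis [simp]:
  "lpart (y + t *\<^sub>R axis (Inl a) 1) = lpart y + t *\<^sub>R axis a 1"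
  "lpart (y + t *\<^sub>R axis (Inr c) 1) = lpart y"
  "rpart (y + t *\<^sub>R axis (Inl a) 1) = rpart y"
  "rpart (y + t *\<^sub>R axis (Inr c) 1) = rpart y + t *\<^sub>R axis c 1"
  by (auto simp: lpart_def rpart_def axis_def vec_eq_iff)

lemma partial_lpart [simp]:
  "partial (Inl a) (\<lambda>y. F (lpart y)) y = partial a F (lpart y)"
  "partial (Inr c) (\<lambda>y. F (lpart y)) y = 0"
  by (simp_all add: partial_def)

lemma partial_rpart [simp]:
  "partial (Inr c) (\<lambda>y. K (rpart y)) y = partial c K (rpart y)"
  "partial (Inl a) (\<lambda>y. K (rpart y)) y = 0"
  by (simp_all add: partial_def)

text \<open>A product of a function on the base and one on the fibre sees only one factor move along each
  coordinate line, so a single factor has to be differentiable.\<close>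

lemma partial_lpart_mult_rpart:
  shows "F differentiable (at (lpart y)) \<Longrightarrow>
      partial (Inl a) (\<lambda>y. F (lpart y) * K (rpart y)) y = partial a F (lpart y) * K (rpart y)"
    and "K differentiable (at (rpart y)) \<Longrightarrow>
      partial (Inr c) (\<lambda>y. F (lpart y) * K (rpart y)) y = F (lpart y) * partial c K (rpart y)"
  using partial_cmult[of F "lpart y" a "K (rpart y)"] partial_cmult[of K "rpart y" c "F (lpart y)"]
  by (simp_all add: partial_def mult.commute)

lemma continuous_on_lpart: "continuous_on S lpart" and continuous_on_rpart: "continuous_on S rpart"
  unfolding lpart_def rpart_def by (intro continuous_intros)+

text \<open>Two metrics in coordinates, over the open sets \<open>U\<close> (base) and \<open>V\<close> (fibre). The last three
  assumptions ask for just enough regularity to differentiate the Christoffel symbols that mix base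
  and fibre, which are built from \<open>\<partial>\<^sub>a f / f\<close> and \<open>f (grad f)\<^sup>a\<close>.\<close>

locale warped_coordinates =
  fixes A :: "real^'b::finite \<Rightarrow> real^'b^'b" and f :: "real^'b \<Rightarrow> real"
    and H :: "real^'c::finite \<Rightarrow> real^'c^'c"
    and U :: "(real^'b) set" and V :: "(real^'c) set"
  assumes open_base: "open U" and open_fibre: "open V"
    and A_inv: "\<And>x. x \<in> U \<Longrightarrow> invertible (A x)"
    and H_inv: "\<And>z. z \<in> V \<Longrightarrow> invertible (H z)"
    and H_sym: "\<And>z. z \<in> V \<Longrightarrow> transpose (H z) = H z"
    and H_diff: "\<And>z c d. z \<in> V \<Longrightarrow> (\<lambda>z. H z $ c $ d) differentiable (at z)"
    and f_nz: "\<And>x. x \<in> U \<Longrightarrow> f x \<noteq> 0"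
    and f_diff: "\<And>x. x \<in> U \<Longrightarrow> f differentiable (at x)"
    and f_diff2: "\<And>x b. x \<in> U \<Longrightarrow> partial b f differentiable (at x)"
    and grad_diff: "\<And>x a. x \<in> U \<Longrightarrow> gradient A f a differentiable (at x)"
begin

abbreviation G where "G \<equiv> warped_metric A f H"

definition W :: "(real^('b + 'c)) set" where
  "W = {y. lpart y \<in> U \<and> rpart y \<in> V}"

lemma open_W: "open W"
proof -
  have "W = lpart -` U \<inter> rpart -` V" by (auto simp: W_def)
  then show ?thesis
    using open_base open_fibre continuous_on_lpart[of UNIV] continuous_on_rpart[of UNIV]
    by (auto simp: continuous_on_open_vimage)
qed

lemma WD: "y \<in> W \<Longrightarrow> lpart y \<in> U" "y \<in> W \<Longrightarrow> rpart y \<in> V"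
  by (auto simp: W_def)

lemma G_simps:
  "G y $ Inl a $ Inl b = A (lpart y) $ a $ b"
  "G y $ Inl a $ Inr d = 0"
  "G y $ Inr c $ Inl b = 0"
  "G y $ Inr c $ Inr d = (f (lpart y))\<^sup>2 * H (rpart y) $ c $ d"
  by (simp_all add: warped_metric_def)

lemma inverse_G:
  assumes "y \<in> W"
  shows "matrix_inv (G y) = (\<chi> s t.
     case (s, t) of
       (Inl a, Inl b) \<Rightarrow> matrix_inv (A (lpart y)) $ a $ b
     | (Inr c, Inr d) \<Rightarrow> matrix_inv (H (rpart y)) $ c $ d / (f (lpart y))\<^sup>2
     | _ \<Rightarrow> 0)" (is "_ = ?B")
proof (rule matrix_inv_eqI)
  note [simp] = matrix_inv_entry[OF A_inv[OF WD(1)[OF assms]]] matrix_inv_entry[OF H_inv[OF WD(2)[OF assms]]]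
    f_nz[OF WD(1)[OF assms]]
  have "(\<Sum>u\<in>UNIV. G y $ s $ u * ?B $ u $ t) = (if s = t then 1 else 0)" for s t
    by (cases s; cases t) (simp_all add: sum_UNIV_sum G_simps)
  then show "G y ** ?B = mat 1"
    by (simp add: vec_eq_iff matrix_matrix_mult_def mat_def)
qed

lemma inverse_G_simps:
  assumes "y \<in> W"
  shows "matrix_inv (G y) $ Inl a $ Inl b = matrix_inv (A (lpart y)) $ a $ b"
  "matrix_inv (G y) $ Inl a $ Inr d = 0"
  "matrix_inv (G y) $ Inr c $ Inl b = 0"
  "matrix_inv (G y) $ Inr c $ Inr d = matrix_inv (H (rpart y)) $ c $ d / (f (lpart y))\<^sup>2"
  by (simp_all add: inverse_G[OF assms])

lemma partial_G:
  assumes "y \<in> W"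
  shows "partial (Inl e) (\<lambda>y. G y $ Inl a $ Inl b) y = partial e (\<lambda>x. A x $ a $ b) (lpart y)"
    "partial (Inr k) (\<lambda>y. G y $ Inl a $ Inl b) y = 0"
    "partial s (\<lambda>y. G y $ Inl a $ Inr d) y = 0"
    "partial s (\<lambda>y. G y $ Inr c $ Inl b) y = 0"
    "partial (Inl e) (\<lambda>y. G y $ Inr c $ Inr d) y =
       2 * f (lpart y) * partial e f (lpart y) * H (rpart y) $ c $ d"
    "partial (Inr k) (\<lambda>y. G y $ Inr c $ Inr d) y =
       (f (lpart y))\<^sup>2 * partial k (\<lambda>z. H z $ c $ d) (rpart y)"
proof -
  have fd: "f differentiable (at (lpart y))"
    using f_diff WD[OF assms] by blast
  have f2: "partial e (\<lambda>x. (f x)\<^sup>2) (lpart y) = 2 * f (lpart y) * partial e f (lpart y)"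
    unfolding power2_eq_square by (subst partial_mult[OF fd fd]) simp
  show "partial (Inl e) (\<lambda>y. G y $ Inl a $ Inl b) y = partial e (\<lambda>x. A x $ a $ b) (lpart y)"
    by (simp add: G_simps partial_lpart(1)[where F="\<lambda>x. A x $ a $ b"])
  show "partial (Inr k) (\<lambda>y. G y $ Inl a $ Inl b) y = 0"
    by (simp add: G_simps partial_lpart(2)[where F="\<lambda>x. A x $ a $ b"])
  show "partial (Inl e) (\<lambda>y. G y $ Inr c $ Inr d) y =
       2 * f (lpart y) * partial e f (lpart y) * H (rpart y) $ c $ d"
    using partial_lpart_mult_rpart(1)[where F="\<lambda>x. (f x)\<^sup>2" and K="\<lambda>z. H z $ c $ d" and y=y and a=e]
      fd by (simp add: f2 G_simps)
  show "partial (Inr k) (\<lambda>y. G y $ Inr c $ Inr d) y =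
       (f (lpart y))\<^sup>2 * partial k (\<lambda>z. H z $ c $ d) (rpart y)"
    using partial_lpart_mult_rpart(2)[where F="\<lambda>x. (f x)\<^sup>2" and K="\<lambda>z. H z $ c $ d" and y=y and c=k]
      H_diff[OF WD(2)[OF assms]] by (simp add: G_simps)
qed (simp_all add: G_simps)

lemma H_commute: "z \<in> V \<Longrightarrow> H z $ c $ d = H z $ d $ c"
  using arg_cong[OF H_sym[of z], of "\<lambda>B. B $ d $ c"] by (simp add: transpose_def)

text \<open>The warping enters only through symbols with two fibre indices: the fibres bend towards the
  base in the direction \<open>- f grad f\<close>, and they are stretched at the rate \<open>\<partial>\<^sub>a f / f\<close>.\<close>

lemma christoffel_G:
  assumes "y \<in> W"
  shows "christoffel G (Inl a) (Inl b) (Inl e) y = christoffel A a b e (lpart y)"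
    "christoffel G (Inl a) (Inl b) (Inr d) y = 0"
    "christoffel G (Inl a) (Inr d) (Inl b) y = 0"
    "christoffel G (Inl a) (Inr c) (Inr d) y =
      - (f (lpart y) * gradient A f a (lpart y)) * H (rpart y) $ c $ d"
    "christoffel G (Inr c) (Inl a) (Inl b) y = 0"
    "christoffel G (Inr c) (Inl a) (Inr d) y =
       (if c = d then partial a f (lpart y) / f (lpart y) else 0)"
    "christoffel G (Inr c) (Inr d) (Inl a) y =
       (if c = d then partial a f (lpart y) / f (lpart y) else 0)"
    "christoffel G (Inr c) (Inr d) (Inr k) y = christoffel H c d k (rpart y)"
proof -
  note [simp] = inverse_G_simps[OF assms] partial_G[OF assms] sum_UNIV_sum
  have nz: "f (lpart y) \<noteq> 0" using f_nz WD[OF assms] by blast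
  note inv = matrix_inv_entry(2)[OF H_inv[OF WD(2)[OF assms]]]
  have comm: "H (rpart y) $ c $ d = H (rpart y) $ d $ c" for c d
    using H_commute WD[OF assms] by blast
  \<comment> \<open>The derivative of \<open>f\<^sup>2\<close> along the base against the inverse \<open>H\<^sup>-\<^sup>1 / f\<^sup>2\<close>: the factors \<open>H\<close> cancel.\<close>
  have red: "1/2 * (\<Sum>l\<in>UNIV. matrix_inv (H (rpart y)) $ c $ l / (f (lpart y))\<^sup>2 *
      (2 * f (lpart y) * partial a f (lpart y) * H (rpart y) $ d $ l)) =
      (if c = d then partial a f (lpart y) / f (lpart y) else 0)" for c d a
  proof -
    have "1/2 * (\<Sum>l\<in>UNIV. matrix_inv (H (rpart y)) $ c $ l / (f (lpart y))\<^sup>2 *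
      (2 * f (lpart y) * partial a f (lpart y) * H (rpart y) $ d $ l)) =
      partial a f (lpart y) / f (lpart y) * (\<Sum>l\<in>UNIV. matrix_inv (H (rpart y)) $ c $ l * H (rpart y) $ l $ d)"
      unfolding sum_distrib_left
      by (rule sum.cong) (use nz in \<open>simp_all add: comm[of d] power2_eq_square field_simps\<close>)
    then show ?thesis by (simp add: inv)
  qed
  show "christoffel G (Inl a) (Inl b) (Inl e) y = christoffel A a b e (lpart y)"
    by (simp add: christoffel_def)
  show "christoffel G (Inl a) (Inl b) (Inr d) y = 0" "christoffel G (Inl a) (Inr d) (Inl b) y = 0"
    "christoffel G (Inr c) (Inl a) (Inl b) y = 0"
    by (simp_all add: christoffel_def)
  show "christoffel G (Inl a) (Inr c) (Inr d) y =
      - (f (lpart y) * gradient A f a (lpart y)) * H (rpart y) $ c $ d"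
    by (simp add: christoffel_def gradient_def sum_distrib_left sum_distrib_right sum_negf mult_ac)
  show "christoffel G (Inr c) (Inl a) (Inr d) y =
       (if c = d then partial a f (lpart y) / f (lpart y) else 0)"
    using red[of c a d] by (simp add: christoffel_def del: times_divide_eq_left)
  show "christoffel G (Inr c) (Inr d) (Inl a) y =
       (if c = d then partial a f (lpart y) / f (lpart y) else 0)"
    using red[of c a d] by (simp add: christoffel_def del: times_divide_eq_left)
  have "(\<Sum>l\<in>UNIV. matrix_inv (H (rpart y)) $ c $ l / (f (lpart y))\<^sup>2 *
     ((f (lpart y))\<^sup>2 * partial d (\<lambda>z. H z $ k $ l) (rpart y)
     + (f (lpart y))\<^sup>2 * partial k (\<lambda>z. H z $ d $ l) (rpart y)
     - (f (lpart y))\<^sup>2 * partial l (\<lambda>z. H z $ d $ k) (rpart y))) =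
    (\<Sum>l\<in>UNIV. matrix_inv (H (rpart y)) $ c $ l *
     (partial d (\<lambda>z. H z $ k $ l) (rpart y)
     + partial k (\<lambda>z. H z $ d $ l) (rpart y)
     - partial l (\<lambda>z. H z $ d $ k) (rpart y)))"
    by (rule sum.cong) (use nz in \<open>simp_all add: field_simps\<close>)
  then show "christoffel G (Inr c) (Inr d) (Inr k) y = christoffel H c d k (rpart y)"
    by (simp add: christoffel_def)
qed

lemma partial_christoffel_G:
  assumes "y \<in> W"
  shows "partial (Inl s) (christoffel G (Inl a) (Inl b) (Inl e)) y = partial s (christoffel A a b e) (lpart y)"
    "partial (Inr c) (christoffel G (Inl a) (Inl b) (Inl e)) y = 0"
    "partial t (christoffel G (Inl a) (Inl b) (Inr d)) y = 0"
    "partial (Inl e) (christoffel G (Inl a) (Inr c) (Inr d)) y =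
       - partial e (\<lambda>x. f x * gradient A f a x) (lpart y) * H (rpart y) $ c $ d"
    "partial t (christoffel G (Inr c) (Inl a) (Inl b)) y = 0"
    "partial (Inl b) (christoffel G (Inr c) (Inr d) (Inl a)) y =
       (if c = d then partial b (partial a f) (lpart y) / f (lpart y)
          - partial a f (lpart y) * partial b f (lpart y) / (f (lpart y))\<^sup>2 else 0)"
    "partial (Inr l) (christoffel G (Inr c) (Inr d) (Inr k)) y = partial l (christoffel H c d k) (rpart y)"
proof -
  note cong = partial_cong_open[OF open_W assms]
  have x: "lpart y \<in> U" using assms WD by blast
  note diff = f_diff[OF x] f_diff2[OF x] grad_diff[OF x]
  show "partial (Inl s) (christoffel G (Inl a) (Inl b) (Inl e)) y = partial s (christoffel A a b e) (lpart y)"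
    "partial (Inr c) (christoffel G (Inl a) (Inl b) (Inl e)) y = 0"
    by (simp_all add: cong[OF christoffel_G(1)])
  show "partial t (christoffel G (Inl a) (Inl b) (Inr d)) y = 0"
    by (simp add: cong[OF christoffel_G(2)])
  show "partial t (christoffel G (Inr c) (Inl a) (Inl b)) y = 0"
    by (simp add: cong[OF christoffel_G(5)])
  show "partial (Inr l) (christoffel G (Inr c) (Inr d) (Inr k)) y = partial l (christoffel H c d k) (rpart y)"
    by (simp add: cong[OF christoffel_G(8)])
  have "partial (Inl e) (christoffel G (Inl a) (Inr c) (Inr d)) y =
      partial (Inl e) (\<lambda>y. - (f (lpart y) * gradient A f a (lpart y)) * H (rpart y) $ c $ d) y"
    by (rule cong[OF christoffel_G(4)])
  also have "\<dots> = partial e (\<lambda>x. - (f x * gradient A f a x)) (lpart y) * H (rpart y) $ c $ d"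
    using partial_lpart_mult_rpart(1)[where F="\<lambda>x. - (f x * gradient A f a x)"
        and K="\<lambda>z. H z $ c $ d" and y=y and a=e] diff by simp
  also have "partial e (\<lambda>x. - (f x * gradient A f a x)) (lpart y) =
      - partial e (\<lambda>x. f x * gradient A f a x) (lpart y)"
    using partial_cmult[of "\<lambda>x. f x * gradient A f a x" "lpart y" e "-1"] diff by simp
  finally show "partial (Inl e) (christoffel G (Inl a) (Inr c) (Inr d)) y =
       - partial e (\<lambda>x. f x * gradient A f a x) (lpart y) * H (rpart y) $ c $ d" .
  have "partial (Inl b) (christoffel G (Inr c) (Inr d) (Inl a)) y =
      partial (Inl b) (\<lambda>y. if c = d then partial a f (lpart y) / f (lpart y) else 0) y"
    by (rule cong[OF christoffel_G(7)])
  then show "partial (Inl b) (christoffel G (Inr c) (Inr d) (Inl a)) y =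
       (if c = d then partial b (partial a f) (lpart y) / f (lpart y)
          - partial a f (lpart y) * partial b f (lpart y) / (f (lpart y))\<^sup>2 else 0)"
    using f_nz[OF x] diff
    by (cases "c = d")
       (simp_all add: partial_lpart(1)[where F="\<lambda>x. partial a f x / f x"] partial_divide
         power2_eq_square field_simps)
qed

text \<open>Each fibre direction \<open>i\<close> contributes the same sectional term \<open>- Hess f / f\<close>: the terms
  \<open>\<partial>\<^sub>a f \<partial>\<^sub>b f / f\<^sup>2\<close> coming from \<open>\<partial>\<^sub>a(\<partial>\<^sub>b f / f)\<close> and from the quadratic part cancel.\<close>

lemma ricci_G_base:
  assumes "y \<in> W"
  shows "ricci G (Inl a) (Inl b) y = ricci A a b (lpart y)
    - real CARD('c) * hess A f a b (lpart y) / f (lpart y)"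
proof -
  let ?x = "lpart y"
  note [simp] = christoffel_G[OF assms] partial_christoffel_G[OF assms]
  have nz: "f ?x \<noteq> 0" using f_nz WD[OF assms] by blast
  have base: "riemann G (Inl i) (Inl i) (Inl a) (Inl b) y = riemann A i i a b ?x" for i
    by (simp add: riemann_def sum_UNIV_sum)
  have fibre: "riemann G (Inr i) (Inr i) (Inl a) (Inl b) y = - (hess A f a b ?x / f ?x)" for i
  proof -
    have "(\<Sum>s\<in>UNIV. - ((if i = s then partial a f ?x / f ?x else 0) * (if s = i then partial b f ?x / f ?x else 0)))
        = (\<Sum>s\<in>UNIV. if i = s then - (partial a f ?x * partial b f ?x / (f ?x)\<^sup>2) else 0)"
      by (rule sum.cong) (auto simp: power2_eq_square)
    then have "(\<Sum>s\<in>UNIV. - ((if i = s then partial a f ?x / f ?x else 0) * (if s = i then partial b f ?x / f ?x else 0)))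
        = - (partial a f ?x * partial b f ?x / (f ?x)\<^sup>2)"
      by simp
    then show ?thesis
      by (simp add: riemann_def sum_UNIV_sum hess_def diff_divide_distrib sum_divide_distrib mult_ac)
  qed
  show ?thesis
    unfolding ricci_def sum_UNIV_sum[of "\<lambda>i. riemann G i i (Inl a) (Inl b) y"] base fibre by simp
qed

text \<open>In the usual form the bracket is \<open>f \<Delta>f + (m - 1) |grad f|\<^sup>2\<close>. The coordinate formula produces
  \<open>div (f grad f)\<close>, which equals \<open>f \<Delta>f + |grad f|\<^sup>2\<close>; keeping it unexpanded spares the identity
  between the divergence of a gradient and the trace of a Hessian for a general metric \<open>A\<close>.\<close>

lemma ricci_G_fibre:
  assumes "y \<in> W"
  shows "ricci G (Inr c) (Inr d) y = ricci H c d (rpart y)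
    - (divergence A (\<lambda>a x. f x * gradient A f a x) (lpart y)
       + (real CARD('c) - 2) * (\<Sum>k\<in>UNIV. partial k f (lpart y) * gradient A f k (lpart y)))
      * H (rpart y) $ c $ d"
proof -
  let ?x = "lpart y" and ?z = "rpart y"
  let ?h = "H ?z $ c $ d" and ?N = "\<Sum>k\<in>UNIV. partial k f ?x * gradient A f k ?x"
  note [simp] = christoffel_G[OF assms] partial_christoffel_G[OF assms]
  have nz: "f ?x \<noteq> 0" using f_nz WD[OF assms] by blast
  have delta: "(\<Sum>s\<in>UNIV. g s * (if s = k then r else 0)) = g k * r"
    "(if k = l then r else 0) * g k = (if k = l then r * g l else 0)"
    for g :: "'c \<Rightarrow> real" and r k l
    by (simp_all add: if_distrib[where f="\<lambda>x. _ * x"] cong: if_cong)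
  have base: "riemann G (Inl i) (Inl i) (Inr c) (Inr d) y =
      - (partial i (\<lambda>x. f x * gradient A f i x) ?x
         + (\<Sum>s\<in>UNIV. christoffel A i i s ?x * (f ?x * gradient A f s ?x))) * ?h
      + partial i f ?x * gradient A f i ?x * ?h" for i
    using nz
    by (simp add: riemann_def sum_UNIV_sum delta)
      (simp add: sum_distrib_left sum_distrib_right sum_negf algebra_simps)
  have fibre: "riemann G (Inr i) (Inr i) (Inr c) (Inr d) y = riemann H i i c d ?z
      - ?N * ?h + (if i = c then ?N * ?h else 0)" for i
    using nz
    by (simp add: riemann_def sum_UNIV_sum sum_distrib_left sum_distrib_right sum_negf sum.distrib
        algebra_simps)
  show ?thesis
    unfolding ricci_def sum_UNIV_sum[of "\<lambda>i. riemann G i i (Inr c) (Inr d) y"] base fibre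
      divergence_def
    by (simp add: sum.distrib sum_subtractf sum_negf sum_distrib_left sum_distrib_right algebra_simps)
qed

text \<open>The trace of the Ricci curvature in block form; the fibre block uses \<open>tr (H\<^sup>-\<^sup>1 H) = m\<close>.\<close>

theorem scalar_curv_G:
  assumes "y \<in> W"
  shows "scalar_curv G y = scalar_curv A (lpart y) + scalar_curv H (rpart y) / (f (lpart y))\<^sup>2
    - real CARD('c) / f (lpart y)
      * (\<Sum>a\<in>UNIV. \<Sum>b\<in>UNIV. matrix_inv (A (lpart y)) $ a $ b * hess A f a b (lpart y))
    - real CARD('c) / (f (lpart y))\<^sup>2
      * (divergence A (\<lambda>a x. f x * gradient A f a x) (lpart y)
         + (real CARD('c) - 2) * (\<Sum>k\<in>UNIV. partial k f (lpart y) * gradient A f k (lpart y)))"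
proof -
  let ?x = "lpart y" and ?z = "rpart y"
  define Q where "Q = divergence A (\<lambda>a x. f x * gradient A f a x) ?x
         + (real CARD('c) - 2) * (\<Sum>k\<in>UNIV. partial k f ?x * gradient A f k ?x)"
  have z: "?z \<in> V" using assms WD by blast
  have tr: "(\<Sum>c\<in>UNIV. \<Sum>d\<in>UNIV. matrix_inv (H ?z) $ c $ d * H ?z $ c $ d) = real CARD('c)"
    by (subst H_commute[OF z]) (simp add: matrix_inv_entry(2)[OF H_inv[OF z]])
  have "(\<Sum>c\<in>UNIV. \<Sum>d\<in>UNIV. matrix_inv (H ?z) $ c $ d / (f ?x)\<^sup>2 * (ricci H c d ?z - Q * H ?z $ c $ d))
      = scalar_curv H ?z / (f ?x)\<^sup>2
        - Q / (f ?x)\<^sup>2 * (\<Sum>c\<in>UNIV. \<Sum>d\<in>UNIV. matrix_inv (H ?z) $ c $ d * H ?z $ c $ d)"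
    by (simp add: scalar_curv_def sum_distrib_left sum_divide_distrib right_diff_distrib
        diff_divide_distrib sum_subtractf mult_ac)
  then have trace: "(\<Sum>c\<in>UNIV. \<Sum>d\<in>UNIV. matrix_inv (H ?z) $ c $ d / (f ?x)\<^sup>2 * (ricci H c d ?z - Q * H ?z $ c $ d))
      = scalar_curv H ?z / (f ?x)\<^sup>2 - real CARD('c) / (f ?x)\<^sup>2 * Q"
    unfolding tr by simp
  show ?thesis
    using trace
    by (simp add: scalar_curv_def[of G] sum_UNIV_sum inverse_G_simps[OF assms] ricci_G_base[OF assms]
        ricci_G_fibre[OF assms] flip: Q_def)
      (simp add: scalar_curv_def algebra_simps sum_subtractf sum_divide_distrib sum_distrib_left)
qed

lemma hess_G:
  assumes "y \<in> W"
  shows "hess G (\<lambda>y. u (lpart y)) (Inl a) (Inl b) y = hess A u a b (lpart y)"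
    "hess G (\<lambda>y. u (lpart y)) (Inl a) (Inr d) y = 0"
    "hess G (\<lambda>y. u (lpart y)) (Inr c) (Inl b) y = 0"
    "hess G (\<lambda>y. u (lpart y)) (Inr c) (Inr d) y =
       f (lpart y) * (\<Sum>k\<in>UNIV. gradient A f k (lpart y) * partial k u (lpart y)) * H (rpart y) $ c $ d"
proof -
  have p: "partial (Inl b) (\<lambda>y :: real^('b + 'c). u (lpart y)) = (\<lambda>y. partial b u (lpart y))"
     "partial (Inr d) (\<lambda>y :: real^('b + 'c). u (lpart y)) = (\<lambda>y. 0)" for b d
    by (auto simp: fun_eq_iff)
  show "hess G (\<lambda>y. u (lpart y)) (Inl a) (Inl b) y = hess A u a b (lpart y)"
    "hess G (\<lambda>y. u (lpart y)) (Inl a) (Inr d) y = 0"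
    "hess G (\<lambda>y. u (lpart y)) (Inr c) (Inl b) y = 0"
    "hess G (\<lambda>y. u (lpart y)) (Inr c) (Inr d) y =
       f (lpart y) * (\<Sum>k\<in>UNIV. gradient A f k (lpart y) * partial k u (lpart y)) * H (rpart y) $ c $ d"
    by (simp_all add: hess_def sum_UNIV_sum p christoffel_G[OF assms] sum_negf sum_distrib_left
        sum_distrib_right mult_ac)
qed

end

section \<open>Conformally flat metrics depending on one linear coordinate\<close>

lemma partial_linear_profile:
  fixes \<alpha> :: "real^'n::finite"
  assumes "g differentiable (at (\<Sum>k\<in>UNIV. \<alpha> $ k * x $ k))"
  shows "partial i (\<lambda>x. g (\<Sum>k\<in>UNIV. \<alpha> $ k * x $ k)) x = \<alpha> $ i * deriv g (\<Sum>k\<in>UNIV. \<alpha> $ k * x $ k)"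
proof (rule partial_eqI)
  let ?s = "\<Sum>k\<in>UNIV. \<alpha> $ k * x $ k"
  have line: "(\<Sum>k\<in>UNIV. \<alpha> $ k * (x + t *\<^sub>R axis i 1) $ k) = ?s + t * \<alpha> $ i" for t
    by (simp add: axis_def algebra_simps sum.distrib mult_delta_right flip: sum_distrib_left)
  have "(g has_field_derivative deriv g ?s) (at (?s + 0 * \<alpha> $ i))"
    using assms by (auto simp: real_differentiable_def DERIV_deriv_iff_has_field_derivative)
  moreover have "((\<lambda>t. ?s + t * \<alpha> $ i) has_field_derivative \<alpha> $ i) (at 0)"
    by (auto intro!: derivative_eq_intros)
  ultimately have "((\<lambda>t. g (?s + t * \<alpha> $ i)) has_field_derivative deriv g ?s * \<alpha> $ i) (at 0)"
    by (rule DERIV_chain2)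
  then
  show "((\<lambda>t. g (\<Sum>k\<in>UNIV. \<alpha> $ k * (x + t *\<^sub>R axis i 1) $ k)) has_real_derivative
      \<alpha> $ i * deriv g ?s) (at 0)"
    unfolding line by (simp add: mult.commute)
qed

lemma DERIV_deriv_real: "(g::real\<Rightarrow>real) differentiable (at s) \<Longrightarrow> (g has_field_derivative deriv g s) (at s)"
  by (auto simp: real_differentiable_def DERIV_deriv_iff_has_field_derivative)

lemma differentiable_linear_profile:
  fixes \<alpha> :: "real^'n::finite" and g :: "real \<Rightarrow> real"
  assumes "\<And>s. g differentiable (at s)"
  shows "(\<lambda>x. g (\<Sum>k\<in>UNIV. \<alpha> $ k * x $ k)) differentiable (at x)"
proof -
  have "(\<lambda>x. \<Sum>k\<in>UNIV. \<alpha> $ k * x $ k) differentiable (at x)"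
    by (intro linear_imp_differentiable linear_compose_sum ballI) (auto intro!: linearI simp: algebra_simps)
  from differentiable_chain_at[OF this assms] show ?thesis
    by (simp add: o_def)
qed

text \<open>The metric \<open>g / \<phi>(\<xi>)\<^sup>2\<close> with \<open>g = diag \<epsilon>\<close>. Components depend on \<open>x\<close> only through \<open>\<xi>\<close>, so
  \<open>\<partial>\<^sub>l\<close> acts on them as \<open>\<alpha>\<^sub>l\<close> times the derivative in \<open>\<xi>\<close>. The symmetric tensors that occur
  are combinations of \<open>\<alpha> \<otimes> \<alpha>\<close> and \<open>g\<close>, written \<open>p \<alpha>\<^sub>i \<alpha>\<^sub>j + (if i = j then \<epsilon>\<^sub>i q else 0)\<close>.\<close>

locale conformal_profile =
  fixes \<epsilon> :: "'n::finite \<Rightarrow> real" and \<alpha> :: "real^'n" and \<phi> :: "real \<Rightarrow> real"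
  assumes signs: "\<And>i. \<epsilon> i \<in> {-1, 1}"
    and phi_nz: "\<And>s. \<phi> s \<noteq> 0"
    and phi_diff: "\<And>s. \<phi> differentiable (at s)"
    and phi_diff2: "\<And>s. deriv \<phi> differentiable (at s)"
begin

definition xi :: "real^'n \<Rightarrow> real" where
  "xi x = (\<Sum>k\<in>UNIV. \<alpha> $ k * x $ k)"

definition alpha_sq :: real where
  "alpha_sq = (\<Sum>k\<in>UNIV. \<epsilon> k * (\<alpha> $ k)\<^sup>2)"

definition A :: "real^'n \<Rightarrow> real^'n^'n" where
  "A x = (1 / (\<phi> (xi x))\<^sup>2) *\<^sub>R (\<chi> i j. if i = j then \<epsilon> i else 0)"

text \<open>For a conformal factor \<open>exp (2 v)\<close>, that is \<open>v = - ln \<bar>\<phi>\<bar>\<close>, this is \<open>- v'\<close>.\<close>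

definition w :: "real \<Rightarrow> real" where
  "w s = deriv \<phi> s / \<phi> s"

lemma sign_square [simp]: "\<epsilon> i * \<epsilon> i = 1" "\<epsilon> i * (\<epsilon> i * t) = t"
  using signs[of i] by auto

lemma partial_xi: "g differentiable (at (xi x)) \<Longrightarrow> partial i (\<lambda>x. g (xi x)) x = \<alpha> $ i * deriv g (xi x)"
  unfolding xi_def by (rule partial_linear_profile)

lemma differentiable_xi: "(\<And>s. g differentiable (at s)) \<Longrightarrow> (\<lambda>x. g (xi x)) differentiable (at x)"
  for g :: "real \<Rightarrow> real"
  unfolding xi_def by (rule differentiable_linear_profile)

lemma deriv_w:
  "w differentiable (at s)"
  "deriv w s = deriv (deriv \<phi>) s / \<phi> s - (deriv \<phi> s)\<^sup>2 / (\<phi> s)\<^sup>2"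
proof -
  have "(w has_field_derivative deriv (deriv \<phi>) s / \<phi> s - (deriv \<phi> s)\<^sup>2 / (\<phi> s)\<^sup>2) (at s)"
    unfolding w_def[abs_def] using phi_nz[of s]
    by (auto intro!: derivative_eq_intros DERIV_deriv_real phi_diff phi_diff2 simp: field_simps power2_eq_square)
  then show "w differentiable (at s)"
    "deriv w s = deriv (deriv \<phi>) s / \<phi> s - (deriv \<phi> s)\<^sup>2 / (\<phi> s)\<^sup>2"
    by (auto simp: real_differentiable_def intro: DERIV_imp_deriv)
qed

lemma A_mult_inverse: "A x ** (\<chi> i j. if i = j then (\<phi> (xi x))\<^sup>2 * \<epsilon> i else 0) = mat 1"
  by (simp add: A_def phi_nz vec_eq_iff matrix_matrix_mult_def mat_def mult_delta_left mult_delta_right)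

lemma inverse_A: "matrix_inv (A x) = (\<chi> i j. if i = j then (\<phi> (xi x))\<^sup>2 * \<epsilon> i else 0)"
  by (rule matrix_inv_eqI[OF A_mult_inverse])

lemma invertible_A: "invertible (A x)"
  using A_mult_inverse invertible_right_inverse by blast

lemma partial_A:
  "partial l (\<lambda>x. A x $ i $ j) x =
    (if i = j then - 2 * w (xi x) / (\<phi> (xi x))\<^sup>2 * \<epsilon> i * \<alpha> $ l else 0)"
proof (cases "i = j")
  case True
  have D: "((\<lambda>s. \<epsilon> i / (\<phi> s)\<^sup>2) has_field_derivative - 2 * w s / (\<phi> s)\<^sup>2 * \<epsilon> i) (at s)" for s
    unfolding w_def using phi_nz[of s]
    by (auto intro!: derivative_eq_intros DERIV_deriv_real phi_diff simp: field_simps power2_eq_square)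
  then have "partial l (\<lambda>x. \<epsilon> i / (\<phi> (xi x))\<^sup>2) x = \<alpha> $ l * (- 2 * w (xi x) / (\<phi> (xi x))\<^sup>2 * \<epsilon> i)"
    using partial_xi[of "\<lambda>s. \<epsilon> i / (\<phi> s)\<^sup>2" x l] DERIV_imp_deriv[OF D, of "xi x"]
    by (auto simp: real_differentiable_def)
  with True show ?thesis
    by (simp add: A_def mult_ac)
qed (simp add: A_def)

text \<open>The constant tensor in the conformal change \<open>\<delta>\<^sup>k\<^sub>i \<partial>\<^sub>j v + \<delta>\<^sup>k\<^sub>j \<partial>\<^sub>i v - g\<^sub>i\<^sub>j \<partial>\<^sup>k v\<close> of the flat
  connection, where \<open>\<partial>\<^sub>j v = - w \<alpha>\<^sub>j\<close>.\<close>

definition C :: "'n \<Rightarrow> 'n \<Rightarrow> 'n \<Rightarrow> real" where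
  "C k i j = (if k = i then \<alpha> $ j else 0) + (if k = j then \<alpha> $ i else 0)
     - (if i = j then \<epsilon> i * \<epsilon> k * \<alpha> $ k else 0)"

lemma christoffel_A: "christoffel A k i j x = - C k i j * w (xi x)"
proof -
  have "(\<Sum>l\<in>UNIV. matrix_inv (A x) $ k $ l *
     (partial i (\<lambda>z. A z $ j $ l) x + partial j (\<lambda>z. A z $ i $ l) x - partial l (\<lambda>z. A z $ i $ j) x))
    = (\<phi> (xi x))\<^sup>2 * \<epsilon> k *
     (partial i (\<lambda>z. A z $ j $ k) x + partial j (\<lambda>z. A z $ i $ k) x - partial k (\<lambda>z. A z $ i $ j) x)"
    by (simp add: inverse_A mult_delta_left)
  then show ?thesis
    using phi_nz[of "xi x"]
    by (auto simp: christoffel_def partial_A C_def field_simps)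
qed

lemma partial_christoffel_A:
  "partial l (christoffel A k i j) x = - C k i j * \<alpha> $ l * deriv w (xi x)"
proof -
  have "partial l (\<lambda>x. - C k i j * w (xi x)) x = - C k i j * (\<alpha> $ l * deriv w (xi x))"
    by (subst partial_cmult) (simp_all add: differentiable_xi deriv_w(1) partial_xi)
  then show ?thesis
    by (simp add: christoffel_A[abs_def])
qed

lemma sum_if_const: "(\<Sum>s\<in>S. if P then g s else 0) = (if P then \<Sum>s\<in>S. g s else 0)"
  for g :: "'k \<Rightarrow> real"
  by simp

lemmas C_sum_simps = mult_delta_left mult_delta_right sum.distrib sum_subtractf sum_if_const
  ring_distribs power2_eq_square sum_distrib_left sum_distrib_right alpha_sq_def

lemma C_trace: "(\<Sum>i\<in>UNIV. C i i k) = real CARD('n) * \<alpha> $ k"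
  by (simp add: C_def C_sum_simps)

lemma C_contract:
  "(\<Sum>s\<in>UNIV. C s j k * \<alpha> $ s) = 2 * \<alpha> $ j * \<alpha> $ k - (if j = k then \<epsilon> j * alpha_sq else 0)"
  by (simp add: C_def C_sum_simps mult_ac)

text \<open>Expanding only the first factor leaves contractions of the second that are already known.\<close>

lemma C_square:
  "(\<Sum>i\<in>UNIV. \<Sum>s\<in>UNIV. C i j s * C s i k) =
    (real CARD('n) + 2) * \<alpha> $ j * \<alpha> $ k - (if j = k then 2 * \<epsilon> j * alpha_sq else 0)"
proof -
  have "(\<Sum>s\<in>UNIV. C i j s * C s i k) =
     (if i = j then 2 * \<alpha> $ i * \<alpha> $ k - (if i = k then \<epsilon> i * alpha_sq else 0) else 0)
     + \<alpha> $ j * C i i k - \<epsilon> j * \<epsilon> i * \<alpha> $ i * C j i k" for i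
  proof -
    have "(\<Sum>s\<in>UNIV. C i j s * C s i k) = (\<Sum>s\<in>UNIV. (if i = j then C s i k * \<alpha> $ s else 0)
        + (if i = s then \<alpha> $ j * C i i k else 0) - (if j = s then \<epsilon> j * \<epsilon> i * \<alpha> $ i * C j i k else 0))"
      by (rule sum.cong) (auto simp: C_def[of i j] algebra_simps)
    then show ?thesis
      by (simp add: sum.distrib sum_subtractf sum_if_const C_contract)
  qed
  then have *: "(\<Sum>i\<in>UNIV. \<Sum>s\<in>UNIV. C i j s * C s i k) =
     2 * \<alpha> $ j * \<alpha> $ k - (if j = k then \<epsilon> j * alpha_sq else 0) + \<alpha> $ j * (\<Sum>i\<in>UNIV. C i i k)
     - \<epsilon> j * (\<Sum>i\<in>UNIV. \<epsilon> i * \<alpha> $ i * C j i k)"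
    by (simp add: sum.distrib sum_subtractf sum_distrib_left mult_ac)
  have **: "\<epsilon> j * (\<Sum>i\<in>UNIV. \<epsilon> i * \<alpha> $ i * C j i k) = (if j = k then \<epsilon> j * alpha_sq else 0)"
    by (simp add: C_def C_sum_simps mult_ac)
  show ?thesis
    unfolding * ** C_trace by (simp add: algebra_simps)
qed

lemma ricci_A:
  "ricci A j k x =
    (real CARD('n) - 2) * (deriv w (xi x) + (w (xi x))\<^sup>2) * \<alpha> $ j * \<alpha> $ k
    + (if j = k then \<epsilon> j * (alpha_sq * (deriv w (xi x) - (real CARD('n) - 2) * (w (xi x))\<^sup>2)) else 0)"
proof -
  let ?w = "w (xi x)" and ?w' = "deriv w (xi x)"
  have *: "ricci A j k x = - ?w' * (\<Sum>i\<in>UNIV. C i j k * \<alpha> $ i) + ?w' * \<alpha> $ j * (\<Sum>i\<in>UNIV. C i i k)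
     + ?w\<^sup>2 * (\<Sum>i\<in>UNIV. \<Sum>s\<in>UNIV. C i i s * C s j k)
     - ?w\<^sup>2 * (\<Sum>i\<in>UNIV. \<Sum>s\<in>UNIV. C i j s * C s i k)"
    by (simp add: ricci_def riemann_def christoffel_A partial_christoffel_A sum.distrib sum_subtractf
        sum_negf sum_distrib_left algebra_simps power2_eq_square)
  have **: "(\<Sum>i\<in>UNIV. \<Sum>s\<in>UNIV. C i i s * C s j k) =
      real CARD('n) * (\<Sum>s\<in>UNIV. C s j k * \<alpha> $ s)"
  proof -
    have "(\<Sum>i\<in>UNIV. \<Sum>s\<in>UNIV. C i i s * C s j k) = (\<Sum>s\<in>UNIV. (\<Sum>i\<in>UNIV. C i i s) * C s j k)"
      by (subst sum.swap) (simp add: sum_distrib_right)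
    then show ?thesis
      by (simp add: C_trace sum_distrib_left mult_ac)
  qed
  show ?thesis
    unfolding * ** C_trace C_contract C_square by (simp add: algebra_simps)
qed

lemma trace_A:
  "(\<Sum>j\<in>UNIV. \<Sum>k\<in>UNIV. matrix_inv (A x) $ j $ k *
      (p * \<alpha> $ j * \<alpha> $ k + (if j = k then \<epsilon> j * q else 0))) =
    (\<phi> (xi x))\<^sup>2 * (p * alpha_sq + real CARD('n) * q)"
  by (simp add: inverse_A C_sum_simps mult_ac)

lemma scalar_curv_A:
  "scalar_curv A x = alpha_sq * (real CARD('n) - 1) *
    (2 * \<phi> (xi x) * deriv (deriv \<phi>) (xi x) - real CARD('n) * (deriv \<phi> (xi x))\<^sup>2)"
proof -
  let ?w = "w (xi x)" and ?w' = "deriv w (xi x)" and ?n = "real CARD('n)"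
  have "scalar_curv A x = (\<phi> (xi x))\<^sup>2 * ((?n - 2) * (?w' + ?w\<^sup>2) * alpha_sq + ?n * (alpha_sq * (?w' - (?n - 2) * ?w\<^sup>2)))"
    unfolding scalar_curv_def ricci_A trace_A ..
  also have "\<dots> = alpha_sq * (?n - 1) * (2 * \<phi> (xi x) * deriv (deriv \<phi>) (xi x) - ?n * (deriv \<phi> (xi x))\<^sup>2)"
    using phi_nz[of "xi x"] unfolding deriv_w(2) w_def by (simp add: field_simps power2_eq_square)
  finally show ?thesis .
qed

context
  fixes u :: "real \<Rightarrow> real"
  assumes u_diff: "\<And>s. u differentiable (at s)"
    and u_diff2: "\<And>s. deriv u differentiable (at s)"
begin

lemma partial_profile: "partial k (\<lambda>x. u (xi x)) = (\<lambda>x. \<alpha> $ k * deriv u (xi x))"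
  by (auto simp: partial_xi u_diff fun_eq_iff)

lemma gradient_profile:
  "gradient A (\<lambda>x. u (xi x)) k = (\<lambda>x. \<epsilon> k * \<alpha> $ k * ((\<phi> (xi x))\<^sup>2 * deriv u (xi x)))"
  by (simp add: gradient_def[abs_def] partial_profile inverse_A mult_delta_left)
    (simp add: mult_ac)

lemma hess_profile:
  "hess A (\<lambda>x. u (xi x)) i j x =
    (deriv (deriv u) (xi x) + 2 * w (xi x) * deriv u (xi x)) * \<alpha> $ i * \<alpha> $ j
    + (if i = j then \<epsilon> i * (- alpha_sq * w (xi x) * deriv u (xi x)) else 0)"
proof -
  have p: "partial i (\<lambda>x. \<alpha> $ j * deriv u (xi x)) x = \<alpha> $ j * (\<alpha> $ i * deriv (deriv u) (xi x))"
    by (subst partial_cmult) (simp_all add: differentiable_xi u_diff2 partial_xi)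
  have c: "(\<Sum>k\<in>UNIV. christoffel A k i j x * (\<alpha> $ k * deriv u (xi x))) =
      - w (xi x) * deriv u (xi x) * (\<Sum>k\<in>UNIV. C k i j * \<alpha> $ k)"
    by (simp add: christoffel_A sum_distrib_left mult_ac)
  show ?thesis
    unfolding hess_def partial_profile p c C_contract by (simp add: algebra_simps)
qed

lemma trace_hess_profile:
  "(\<Sum>i\<in>UNIV. \<Sum>j\<in>UNIV. matrix_inv (A x) $ i $ j * hess A (\<lambda>x. u (xi x)) i j x) =
    alpha_sq * (\<phi> (xi x))\<^sup>2 *
      (deriv (deriv u) (xi x) - (real CARD('n) - 2) * w (xi x) * deriv u (xi x))"
  unfolding hess_profile trace_A by (simp add: algebra_simps)

lemma gradient_product_profile:
  "(\<Sum>k\<in>UNIV. \<alpha> $ k * r * gradient A (\<lambda>x. u (xi x)) k x) = alpha_sq * r * (\<phi> (xi x))\<^sup>2 * deriv u (xi x)"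
  by (simp add: gradient_profile alpha_sq_def sum_distrib_right sum_distrib_left power2_eq_square mult_ac)

text \<open>The field is \<open>v(\<xi>) (\<epsilon>\<^sub>k \<alpha>\<^sub>k)\<^sub>k\<close> with \<open>v = u \<phi>\<^sup>2 u'\<close>, so its divergence is
  \<open>(v' - n w v) \<Sum>\<^sub>k \<epsilon>\<^sub>k \<alpha>\<^sub>k\<^sup>2\<close>.\<close>

lemma divergence_profile:
  "divergence A (\<lambda>k x. u (xi x) * gradient A (\<lambda>x. u (xi x)) k x) x =
    alpha_sq * (\<phi> (xi x))\<^sup>2 * ((deriv u (xi x))\<^sup>2 + u (xi x) * deriv (deriv u) (xi x)
      - (real CARD('n) - 2) * w (xi x) * u (xi x) * deriv u (xi x))"
proof -
  let ?v = "\<lambda>s. u s * ((\<phi> s)\<^sup>2 * deriv u s)"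
  let ?v' = "\<lambda>s. (\<phi> s)\<^sup>2 * ((deriv u s)\<^sup>2 + u s * deriv (deriv u) s + 2 * w s * u s * deriv u s)"
  have D: "(?v has_field_derivative ?v' s) (at s)" for s
    unfolding w_def using phi_nz[of s]
    by (auto intro!: derivative_eq_intros DERIV_deriv_real phi_diff u_diff u_diff2
        simp: field_simps power2_eq_square)
  then have v: "?v differentiable (at s)" "deriv ?v s = ?v' s" for s
    by (auto simp: real_differentiable_def intro: DERIV_imp_deriv)
  have X: "(\<lambda>x. u (xi x) * gradient A (\<lambda>x. u (xi x)) k x) = (\<lambda>x. \<epsilon> k * \<alpha> $ k * ?v (xi x))" for k
    by (simp add: gradient_profile mult_ac)
  have "partial k (\<lambda>x. \<epsilon> k * \<alpha> $ k * ?v (xi x)) x = \<epsilon> k * \<alpha> $ k * (\<alpha> $ k * ?v' (xi x))" for k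
    using partial_xi[OF v(1), of k x] differentiable_xi[OF v(1), of x]
    by (subst partial_cmult) (simp_all only: v(2))
  then have div: "divergence A (\<lambda>k x. u (xi x) * gradient A (\<lambda>x. u (xi x)) k x) x =
      (\<Sum>k\<in>UNIV. \<epsilon> k * \<alpha> $ k * (\<alpha> $ k * ?v' (xi x)))
      + (\<Sum>i\<in>UNIV. \<Sum>s\<in>UNIV. - C i i s * w (xi x) * (\<epsilon> s * \<alpha> $ s * ?v (xi x)))"
    unfolding divergence_def X christoffel_A by (simp add: sum.distrib)
  have derivative_term: "(\<Sum>k\<in>UNIV. \<epsilon> k * \<alpha> $ k * (\<alpha> $ k * t)) = alpha_sq * t" for t
    by (simp add: alpha_sq_def sum_distrib_right sum_distrib_left power2_eq_square mult_ac)
  have christoffel_term: "(\<Sum>i\<in>UNIV. \<Sum>s\<in>UNIV. - C i i s * r * (\<epsilon> s * \<alpha> $ s * t)) = - real CARD('n) * r * alpha_sq * t"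
    for r t
  proof -
    have "(\<Sum>i\<in>UNIV. \<Sum>s\<in>UNIV. - C i i s * r * (\<epsilon> s * \<alpha> $ s * t))
      = (\<Sum>s\<in>UNIV. (\<Sum>i\<in>UNIV. C i i s) * (- r * (\<epsilon> s * \<alpha> $ s * t)))"
      by (subst sum.swap) (simp add: sum_distrib_right sum_distrib_left sum_negf mult_ac)
    then show ?thesis
      unfolding C_trace
      by (simp add: alpha_sq_def sum_distrib_right sum_distrib_left power2_eq_square mult_ac sum_negf)
  qed
  show ?thesis
    unfolding div derivative_term christoffel_term by (simp add: algebra_simps)
qed

end

end

section \<open>The soliton equation on the warped product\<close>

lemma smooth_on_differentiable:
  assumes "smooth_on S F" "open S" "x \<in> S"
  shows "F differentiable (at x)" "partial k F differentiable (at x)"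
proof -
  have "foldr partial ks F differentiable_on S" for ks
    using assms(1) by (auto simp: smooth_on_def)
  from this[of "[]"] this[of "[k]"] assms(2,3)
  show "F differentiable (at x)" "partial k F differentiable (at x)"
    by (auto simp: differentiable_on_eq_differentiable_at)
qed

text \<open>As \<open>\<alpha> \<noteq> 0\<close>, some coordinate line maps onto \<open>\<real>\<close> under \<open>\<xi>\<close>. Along it the profile is recovered
  from the function on \<open>\<real>\<^sup>n\<close>, and its derivative from a partial derivative.\<close>

lemma smooth_profile_differentiable:
  fixes \<alpha> :: "real^'n::finite" and g :: "real \<Rightarrow> real"
  assumes "smooth_on UNIV F" and \<alpha>: "\<alpha> \<noteq> 0"
    and F: "\<And>x. F x = g (\<Sum>k\<in>UNIV. \<alpha> $ k * x $ k)"
  shows "g differentiable (at s)" "deriv g differentiable (at s)"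
proof -
  from \<alpha> obtain i where i: "\<alpha> $ i \<noteq> 0"
    by (auto simp: vec_eq_iff)
  define \<sigma> where "\<sigma> s = s *\<^sub>R axis i (1 / \<alpha> $ i)" for s
  have section_xi: "(\<Sum>k\<in>UNIV. \<alpha> $ k * \<sigma> s $ k) = s" for s
  proof -
    have "(\<Sum>k\<in>UNIV. \<alpha> $ k * \<sigma> s $ k) = (\<Sum>k\<in>UNIV. if k = i then s else 0)"
      by (rule sum.cong) (use i in \<open>auto simp: \<sigma>_def axis_def\<close>)
    then show ?thesis by simp
  qed
  have \<sigma>: "\<sigma> differentiable (at s)" for s
    unfolding \<sigma>_def[abs_def] by (auto intro!: derivative_intros)
  have g: "g differentiable (at s)" for s
    using differentiable_chain_at[OF \<sigma> smooth_on_differentiable(1)[OF assms(1)], of s]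
    by (simp add: o_def F section_xi)
  then show "g differentiable (at s)" .
  have "partial i F x = \<alpha> $ i * deriv g (\<Sum>k\<in>UNIV. \<alpha> $ k * x $ k)" for x
    unfolding ext[of F, OF F] by (rule partial_linear_profile[OF g])
  then have "deriv g = (\<lambda>s. partial i F (\<sigma> s) * (1 / \<alpha> $ i))"
    using i by (simp add: section_xi fun_eq_iff)
  moreover have "(\<lambda>s. partial i F (\<sigma> s) * (1 / \<alpha> $ i)) differentiable (at s)"
  proof (rule differentiable_mult[OF _ differentiable_const])
    have "partial i F differentiable (at (\<sigma> s))"
      by (rule smooth_on_differentiable(2)[OF assms(1)]) auto
    from differentiable_chain_at[OF \<sigma> this]
    show "(\<lambda>s. partial i F (\<sigma> s)) differentiable (at s)"
      by (simp only: o_def)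
  qed
  ultimately show "deriv g differentiable (at s)"
    by (simp only:)
qed

text \<open>A nondegenerate diagonal matrix of size at least two has rank at least two, so it is not a
  multiple of \<open>\<alpha> \<otimes> \<alpha>\<close>. This is what splits the base part of the soliton equation into two scalar
  equations.\<close>

lemma diagonal_eq_rank_one_iff:
  fixes \<alpha> :: "real^'n::finite"
  assumes "CARD('n) \<ge> 2" "\<alpha> \<noteq> 0" "\<And>i. \<epsilon> i \<noteq> (0::real)"
  shows "(\<forall>i j. p * \<alpha> $ i * \<alpha> $ j + (if i = j then \<epsilon> i * q else 0) = 0) \<longleftrightarrow> p = 0 \<and> q = 0"
proof
  assume eq: "\<forall>i j. p * \<alpha> $ i * \<alpha> $ j + (if i = j then \<epsilon> i * q else 0) = 0"
  from \<open>\<alpha> \<noteq> 0\<close> obtain i where i: "\<alpha> $ i \<noteq> 0"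
    by (auto simp: vec_eq_iff)
  have "UNIV \<noteq> {i}"
    using assms(1) by (metis One_nat_def card.empty card.insert empty_iff finite.emptyI
        not_less_eq_eq numeral_2_eq_2 order_refl)
  then obtain j where j: "j \<noteq> i"
    by auto
  from eq have "p * \<alpha> $ i * \<alpha> $ j = 0" "p * \<alpha> $ j * \<alpha> $ j + \<epsilon> j * q = 0"
      "p * \<alpha> $ i * \<alpha> $ i + \<epsilon> i * q = 0"
    using j by (metis add_0_right)+
  with i assms(3) show "p = 0 \<and> q = 0"
    by (cases "p = 0") auto
qed auto

theorem theorem1p6:
  fixes \<epsilon> :: "'n::finite \<Rightarrow> real" and \<alpha> :: "real^'n"
    and F :: "('j, 'q::{t2_space, second_countable_topology}, 'm::finite) semi_riem"
    and f \<phi> h :: "real^'n \<Rightarrow> real"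
    and f0 \<phi>0 h0 :: "real \<Rightarrow> real"
    and lamF \<rho> e n m :: real
  assumes e: "e = (\<Sum>k\<in>UNIV. \<epsilon> k * (\<alpha> $ k)\<^sup>2)"
    and n: "n = real CARD('n)" and m: "m = real CARD('m)"
    and dim: "CARD('n) \<ge> 3"
    and signs: "\<And>i. \<epsilon> i \<in> {-1, 1}"
    and F: "semi_riemannian F" "has_constant_scalar_curvature F lamF"
    and smooth: "smooth_on UNIV f" "smooth_on UNIV \<phi>" "smooth_on UNIV h"
    and f_pos: "\<And>x. f x > 0"
    and \<phi>_nonzero: "\<And>x. \<phi> x \<noteq> 0"
    and f_xi: "\<And>x. f x = f0 (\<Sum>k\<in>UNIV. \<alpha> $ k * x $ k)"
    and \<phi>_xi: "\<And>x. \<phi> x = \<phi>0 (\<Sum>k\<in>UNIV. \<alpha> $ k * x $ k)"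
    and h_xi: "\<And>x. h x = h0 (\<Sum>k\<in>UNIV. \<alpha> $ k * x $ k)"
    and \<alpha>: "\<alpha> \<noteq> 0" "e \<in> {-1, 1} \<or> e = 0"
  shows "gradient_yamabe_soliton
           (warped_product (conformal \<phi> (pseudo_euclidean \<epsilon>)) f F) (\<lambda>(x, q). h x) \<rho> \<longleftrightarrow>
         (e \<in> {-1, 1} \<longrightarrow> (\<forall>\<xi>.
            deriv (deriv h0) \<xi> + 2 * (deriv \<phi>0 \<xi> * deriv h0 \<xi> / \<phi>0 \<xi>) = 0 \<and>
            e * ((n - 1) * (2 * \<phi>0 \<xi> * deriv (deriv \<phi>0) \<xi> - n * (deriv \<phi>0 \<xi>)\<^sup>2)
                 - 2 * m / f0 \<xi> * ((\<phi>0 \<xi>)\<^sup>2 * deriv (deriv f0) \<xi>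
                                  - (n - 2) * \<phi>0 \<xi> * deriv \<phi>0 \<xi> * deriv f0 \<xi>)
                 - m * (m - 1) / (f0 \<xi>)\<^sup>2 * (\<phi>0 \<xi>)\<^sup>2 * (deriv f0 \<xi>)\<^sup>2
                 + deriv \<phi>0 \<xi> * deriv h0 \<xi> * \<phi>0 \<xi>)
              = \<rho> - lamF / (f0 \<xi>)\<^sup>2 \<and>
            e * ((n - 1) * (2 * \<phi>0 \<xi> * deriv (deriv \<phi>0) \<xi> - n * (deriv \<phi>0 \<xi>)\<^sup>2)
                 - 2 * m / f0 \<xi> * ((\<phi>0 \<xi>)\<^sup>2 * deriv (deriv f0) \<xi>
                                  - (n - 2) * \<phi>0 \<xi> * deriv \<phi>0 \<xi> * deriv f0 \<xi>)
                 - m * (m - 1) / (f0 \<xi>)\<^sup>2 * (\<phi>0 \<xi>)\<^sup>2 * (deriv f0 \<xi>)\<^sup>2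
                 - (\<phi>0 \<xi>)\<^sup>2 / f0 \<xi> * deriv f0 \<xi> * deriv h0 \<xi>)
              = \<rho> - lamF / (f0 \<xi>)\<^sup>2)) \<and>
         (e = 0 \<longrightarrow> (\<forall>\<xi>.
            deriv (deriv h0) \<xi> + 2 * (deriv \<phi>0 \<xi> * deriv h0 \<xi> / \<phi>0 \<xi>) = 0 \<and>
            \<rho> - lamF / (f0 \<xi>)\<^sup>2 = 0))"
proof -
  from \<alpha>(1) obtain i where i: "\<alpha> $ i \<noteq> 0"
    by (auto simp: vec_eq_iff)
  have surj: "\<exists>x. (\<Sum>k\<in>UNIV. \<alpha> $ k * x $ k) = s" for s
    by (rule exI[of _ "axis i (s / \<alpha> $ i)"]) (use i in \<open>simp add: axis_def mult_delta_right\<close>)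
  have nz: "\<phi>0 s \<noteq> 0" "f0 s > 0" for s
    using surj[of s] \<phi>_nonzero f_pos \<phi>_xi f_xi by metis+
  note f0 = smooth_profile_differentiable[OF smooth(1) \<alpha>(1) f_xi]
    and \<phi>0 = smooth_profile_differentiable[OF smooth(2) \<alpha>(1) \<phi>_xi]
    and h0 = smooth_profile_differentiable[OF smooth(3) \<alpha>(1) h_xi]
  interpret B: conformal_profile \<epsilon> \<alpha> \<phi>0
    by unfold_locales (use signs nz \<phi>0 in auto)
  have e_eq: "B.alpha_sq = e"
    by (simp add: e B.alpha_sq_def)
  have f_eq: "f = (\<lambda>x. f0 (B.xi x))" and \<phi>_eq: "\<phi> = (\<lambda>x. \<phi>0 (B.xi x))" and h_eq: "h = (\<lambda>x. h0 (B.xi x))"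
    by (auto simp: fun_eq_iff f_xi \<phi>_xi h_xi B.xi_def)
  have surj_xi: "\<exists>x. B.xi x = s" for s
    using surj by (simp add: B.xi_def)

  \<comment> \<open>\<open>S\<close> is the scalar curvature along \<open>\<xi>\<close>. The base block of the soliton equation is
    \<open>q g / \<phi>\<^sup>2 = p \<alpha> \<otimes> \<alpha>\<close> and the fibre block is \<open>r f\<^sup>2 g\<^sub>F = 0\<close>.\<close>
  define S where "S s = e * (n - 1) * (2 * \<phi>0 s * deriv (deriv \<phi>0) s - n * (deriv \<phi>0 s)\<^sup>2)
    + lamF / (f0 s)\<^sup>2
    - 2 * m / f0 s * (e * ((\<phi>0 s)\<^sup>2 * deriv (deriv f0) s - (n - 2) * \<phi>0 s * deriv \<phi>0 s * deriv f0 s))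
    - m * (m - 1) / (f0 s)\<^sup>2 * (e * (\<phi>0 s)\<^sup>2 * (deriv f0 s)\<^sup>2)" for s
  define p where "p s = deriv (deriv h0) s + 2 * (deriv \<phi>0 s * deriv h0 s / \<phi>0 s)" for s
  define q where "q s = S s - \<rho> + e * \<phi>0 s * deriv \<phi>0 s * deriv h0 s" for s
  define r where "r s = S s - \<rho> - e * (\<phi>0 s)\<^sup>2 / f0 s * deriv f0 s * deriv h0 s" for s

  let ?M = "warped_product (conformal \<phi> (pseudo_euclidean \<epsilon>)) f F"
  have man: "smooth_manifold F"
    using F(1) by (simp add: semi_riemannian_def)
  have pointwise: "(scalar_curvature ?M ((), j) (x, y) - \<rho>) *\<^sub>R gcomp ?M ((), j) (x, y)
        = hessian ?M (\<lambda>(x, q). h x) ((), j) (x, y)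
      \<longleftrightarrow> p (B.xi x) = 0 \<and> q (B.xi x) = 0 \<and> r (B.xi x) = 0"
    if j: "j \<in> atlas F" and y: "y \<in> cdom F j" for j x y
  proof -
    define H where "H = local_metric F j"
    define z where "z = coords F j y"
    define c where "c = (\<chi> s. case s of Inl a \<Rightarrow> x $ a | Inr c \<Rightarrow> z $ c)"
    have hom: "homeomorphism (cdom F j) (cimage F j) (coords F j) (param F j)"
      and opn: "open (cimage F j)"
      using man j by (auto simp: smooth_manifold_def)
    have pz: "param F j z = y"
      using hom y by (auto simp: z_def homeomorphism_def)
    have Hz: "H z = gcomp F j y"
      by (simp add: H_def local_metric_def pz)
    have reg: "transpose (H z) = H z \<and> invertible (H z)" "(\<lambda>z. H z $ a $ b) differentiable (at z)"
      if "z \<in> cimage F j" for z a b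
    proof -
      have "param F j z \<in> cdom F j"
        using hom that by (auto simp: homeomorphism_def)
      then show "transpose (H z) = H z \<and> invertible (H z)"
        using F(1) j by (auto simp: semi_riemannian_def H_def local_metric_def)
      have "smooth_on (cimage F j) (\<lambda>y. gcomp F j (param F j y) $ a $ b)"
        using F(1) j by (simp add: semi_riemannian_def)
      from smooth_on_differentiable(1)[OF this opn that]
      show "(\<lambda>z. H z $ a $ b) differentiable (at z)"
        by (simp add: H_def local_metric_def)
    qed
    interpret G: warped_coordinates B.A f H UNIV "cimage F j"
    proof unfold_locales
      show "f differentiable (at x)" "partial b f differentiable (at x)" for x b
        using smooth_on_differentiable[OF smooth(1)] by auto
      show "gradient B.A f a differentiable (at x)" for x a
        unfolding f_eq B.gradient_profile[OF f0]
        by (intro differentiable_mult differentiable_const B.differentiable_xi differentiable_power f0 \<phi>0)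
    qed (use opn reg B.invertible_A f_pos less_irrefl in \<open>auto, metis\<close>)
    have c: "lpart c = x" "rpart c = z"
      by (simp_all add: lpart_def rpart_def c_def)
    have "z \<in> cimage F j"
      using y by (simp add: cimage_def z_def)
    then have cW: "c \<in> G.W"
      by (simp add: G.W_def c)
    have coords: "coords ?M ((), j) (x, y) = c"
      unfolding c_def z_def by (simp add: warped_product_def conformal_def pseudo_euclidean_def)
    have metric: "local_metric ?M ((), j) = G.G"
      by (auto simp: fun_eq_iff local_metric_def warped_product_def conformal_def pseudo_euclidean_def
          warped_metric_def lpart_def rpart_def H_def B.A_def \<phi>_eq vec_eq_iff split: sum.splits)
    have gcomp: "gcomp ?M ((), j) (x, y) = G.G c"
      by (auto simp: warped_product_def conformal_def pseudo_euclidean_def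
          warped_metric_def c Hz B.A_def \<phi>_eq vec_eq_iff split: sum.splits)
    have potential: "(\<lambda>y. (\<lambda>(x, q). h x) (param ?M ((), j) y)) = (\<lambda>y. h (lpart y))"
      by (auto simp: warped_product_def conformal_def pseudo_euclidean_def lpart_def)

    let ?s = "B.xi x"
    have fx: "f x = f0 ?s"
      by (simp add: f_eq)
    have SH: "scalar_curv H z = lamF"
      using F(2) j y by (auto simp: has_constant_scalar_curvature_def scalar_curvature_def H_def z_def)
    have norm: "(\<Sum>k\<in>UNIV. partial k f x * gradient B.A f k x) = e * (\<phi>0 ?s)\<^sup>2 * (deriv f0 ?s)\<^sup>2"
      unfolding f_eq B.partial_profile[OF f0] B.gradient_product_profile[OF f0] e_eq
      by (simp add: power2_eq_square)
    have scal: "scalar_curvature ?M ((), j) (x, y) = S ?s"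
      unfolding scalar_curvature_def metric coords G.scalar_curv_G[OF cW] c SH norm
      unfolding f_eq B.trace_hess_profile[OF f0] B.divergence_profile[OF f0] B.scalar_curv_A S_def
        e_eq B.w_def n m
      using nz[of ?s] by (simp add: field_simps power2_eq_square)
    have "(\<Sum>k\<in>UNIV. gradient B.A f k x * partial k h x) = e * deriv h0 ?s * (\<phi>0 ?s)\<^sup>2 * deriv f0 ?s"
      unfolding f_eq h_eq B.partial_profile[OF h0] using B.gradient_product_profile[OF f0, of "deriv h0 ?s" x] e_eq
      by (simp add: mult_ac)
    then have hess_fibre: "hess G.G (\<lambda>y. h (lpart y)) (Inr a) (Inr b) c =
        f0 ?s * (e * deriv h0 ?s * (\<phi>0 ?s)\<^sup>2 * deriv f0 ?s) * H z $ a $ b" for a b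
      unfolding G.hess_G[OF cW] c by (simp add: f_eq)
    have hess_base: "hess G.G (\<lambda>y. h (lpart y)) (Inl a) (Inl b) c = p ?s * \<alpha> $ a * \<alpha> $ b
        + (if a = b then \<epsilon> a * (- e * (deriv \<phi>0 ?s / \<phi>0 ?s) * deriv h0 ?s) else 0)" for a b
      unfolding G.hess_G[OF cW] c unfolding h_eq B.hess_profile[OF h0] e_eq p_def B.w_def by simp
    have "(scalar_curvature ?M ((), j) (x, y) - \<rho>) *\<^sub>R gcomp ?M ((), j) (x, y)
        = hessian ?M (\<lambda>(x, q). h x) ((), j) (x, y) \<longleftrightarrow>
      (\<forall>s t. (S ?s - \<rho>) * G.G c $ s $ t = hess G.G (\<lambda>y. h (lpart y)) s t c)"
      unfolding hessian_def metric coords gcomp scal potential by (simp add: vec_eq_iff)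
    also have "\<dots> \<longleftrightarrow>
      (\<forall>a b. (S ?s - \<rho>) * B.A x $ a $ b = hess G.G (\<lambda>y. h (lpart y)) (Inl a) (Inl b) c) \<and>
      (\<forall>a b. (S ?s - \<rho>) * ((f0 ?s)\<^sup>2 * H z $ a $ b) = hess G.G (\<lambda>y. h (lpart y)) (Inr a) (Inr b) c)"
      by (simp add: split_sum_all G.G_simps G.hess_G(2,3)[OF cW] c fx all_conj_distrib)
    also have "(\<forall>a b. (S ?s - \<rho>) * B.A x $ a $ b = hess G.G (\<lambda>y. h (lpart y)) (Inl a) (Inl b) c) \<longleftrightarrow>
      (\<forall>a b. - p ?s * \<alpha> $ a * \<alpha> $ b + (if a = b then \<epsilon> a * (q ?s / (\<phi>0 ?s)\<^sup>2) else 0) = 0)"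
    proof -
      have "(S ?s - \<rho>) * B.A x $ a $ b - hess G.G (\<lambda>y. h (lpart y)) (Inl a) (Inl b) c =
         - p ?s * \<alpha> $ a * \<alpha> $ b + (if a = b then \<epsilon> a * (q ?s / (\<phi>0 ?s)\<^sup>2) else 0)" for a b
        unfolding hess_base q_def B.A_def using nz[of ?s] by (simp add: field_simps power2_eq_square)
      then show ?thesis
        by (subst eq_iff_diff_eq_0) (simp only:)
    qed
    also have "\<dots> \<longleftrightarrow> p ?s = 0 \<and> q ?s = 0"
    proof -
      have "\<epsilon> a \<noteq> 0" for a
        using signs[of a] by auto
      with dim \<alpha>(1) have "(\<forall>a b. - p ?s * \<alpha> $ a * \<alpha> $ b
          + (if a = b then \<epsilon> a * (q ?s / (\<phi>0 ?s)\<^sup>2) else 0) = 0)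
        \<longleftrightarrow> - p ?s = 0 \<and> q ?s / (\<phi>0 ?s)\<^sup>2 = 0"
        by (intro diagonal_eq_rank_one_iff) auto
      then show ?thesis
        using nz[of ?s] by simp
    qed
    also have "(\<forall>a b. (S ?s - \<rho>) * ((f0 ?s)\<^sup>2 * H z $ a $ b) = hess G.G (\<lambda>y. h (lpart y)) (Inr a) (Inr b) c)
      \<longleftrightarrow> r ?s = 0"
    proof -
      have "(S ?s - \<rho>) * ((f0 ?s)\<^sup>2 * H z $ a $ b) - hess G.G (\<lambda>y. h (lpart y)) (Inr a) (Inr b) c
        = r ?s * (f0 ?s)\<^sup>2 * H z $ a $ b" for a b
        unfolding hess_fibre r_def using nz[of ?s] by (simp add: field_simps power2_eq_square)
      then have "(\<forall>a b. (S ?s - \<rho>) * ((f0 ?s)\<^sup>2 * H z $ a $ b) = hess G.G (\<lambda>y. h (lpart y)) (Inr a) (Inr b) c)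
        \<longleftrightarrow> (\<forall>a b. r ?s * (f0 ?s)\<^sup>2 * H z $ a $ b = 0)"
        by (subst eq_iff_diff_eq_0) (simp only:)
      \<comment> \<open>\<open>H z\<close> is invertible and has at least one row, index types being nonempty.\<close>
      moreover have "\<exists>a b. H z $ a $ b \<noteq> 0"
      proof (rule ccontr)
        assume "\<not> ?thesis"
        then show False
          using matrix_inv_entry(1)[OF G.H_inv[OF \<open>z \<in> cimage F j\<close>], of undefined undefined] by simp
      qed
      ultimately show ?thesis
        using nz(2)[of ?s] by auto
    qed
    finally show ?thesis by blast
  qed
  have soliton: "gradient_yamabe_soliton ?M (\<lambda>(x, q). h x) \<rho> \<longleftrightarrow> (\<forall>s. p s = 0 \<and> q s = 0 \<and> r s = 0)"
  proof -
    have charts: "atlas ?M = UNIV \<times> atlas F" "cdom ?M ((), j) = UNIV \<times> cdom F j" for j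
      by (auto simp: warped_product_def conformal_def pseudo_euclidean_def)
    \<comment> \<open>The fibre has a point, so the equation at \<open>(x, y)\<close> reaches every value of \<open>\<xi>\<close>.\<close>
    obtain j y where "j \<in> atlas F" "y \<in> cdom F j"
      using man by (auto simp: smooth_manifold_def) (metis UNIV_I UN_iff)
    then show ?thesis
      using surj_xi pointwise unfolding gradient_yamabe_soliton_def charts
      by (auto simp: charts) metis+
  qed
  have q_iff: "q s = 0 \<longleftrightarrow> e * ((n - 1) * (2 * \<phi>0 s * deriv (deriv \<phi>0) s - n * (deriv \<phi>0 s)\<^sup>2)
                 - 2 * m / f0 s * ((\<phi>0 s)\<^sup>2 * deriv (deriv f0) s
                                  - (n - 2) * \<phi>0 s * deriv \<phi>0 s * deriv f0 s)
                 - m * (m - 1) / (f0 s)\<^sup>2 * (\<phi>0 s)\<^sup>2 * (deriv f0 s)\<^sup>2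
                 + deriv \<phi>0 s * deriv h0 s * \<phi>0 s)
              = \<rho> - lamF / (f0 s)\<^sup>2" (is "_ \<longleftrightarrow> ?a = ?b") for s
  proof -
    have "q s = ?a - ?b"
      by (simp add: q_def S_def algebra_simps)
    then show ?thesis by simp
  qed
  have r_iff: "r s = 0 \<longleftrightarrow> e * ((n - 1) * (2 * \<phi>0 s * deriv (deriv \<phi>0) s - n * (deriv \<phi>0 s)\<^sup>2)
                 - 2 * m / f0 s * ((\<phi>0 s)\<^sup>2 * deriv (deriv f0) s
                                  - (n - 2) * \<phi>0 s * deriv \<phi>0 s * deriv f0 s)
                 - m * (m - 1) / (f0 s)\<^sup>2 * (\<phi>0 s)\<^sup>2 * (deriv f0 s)\<^sup>2
                 - (\<phi>0 s)\<^sup>2 / f0 s * deriv f0 s * deriv h0 s)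
              = \<rho> - lamF / (f0 s)\<^sup>2" (is "_ \<longleftrightarrow> ?a = ?b") for s
  proof -
    have "r s = ?a - ?b"
      by (simp add: r_def S_def algebra_simps)
    then show ?thesis by simp
  qed
  have "q s = lamF / (f0 s)\<^sup>2 - \<rho>" "r s = lamF / (f0 s)\<^sup>2 - \<rho>" if "e = 0" for s
    using that by (simp_all add: q_def r_def S_def)
  then have null: "q s = 0 \<and> r s = 0 \<longleftrightarrow> \<rho> - lamF / (f0 s)\<^sup>2 = 0" if "e = 0" for s
    using that by auto
  from \<alpha>(2) show ?thesis
  proof
    assume "e \<in> {-1, 1}"
    then show ?thesis
      unfolding soliton q_iff r_iff p_def by auto
  next
    assume "e = 0"
    then show ?thesis
      unfolding soliton null[OF \<open>e = 0\<close>] p_def by simp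
  qed
qed

end
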